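(* Let $p,q$ be positive integers with $p<q$ and $2p\neq q$, put $a=\frac{q}{p}$, and let $0<\alpha<\pi$. Let a hypocycloid be given by the parametrization $$\left(\frac{(a-1)\cos t+\cos((a-1)t)}{a},\ \frac{(a-1)\sin t-\sin((a-1)t)}{a}\right),\qquad t\in[0,2q\pi].$$ Then its $\alpha$-isoptic curve is a hypotrochoid given by the parametrization $$\left((A-B)\cos t+H\cos\left(\tfrac{A-B}{B}t\right),\ (A-B)\sin t-H\sin\left(\tfrac{A-B}{B}t\right)\right),$$ where $$A=\frac{(a-2)\sin\left(\frac{(a-1)\alpha}{a-2}\right)}{(a-1)\sin\alpha},\qquad B=\frac{(a-2)\sin\left(\frac{(a-1)\alpha}{a-2}\right)}{a(a-1)\sin\alpha},\qquad H=\frac{(a-2)\sin\left(\frac{\alpha}{a-2}\right)}{a\sin\alpha}.$$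
   Context: We work in the Euclidean plane. For $0<\alpha<\pi$, the $\alpha$-isoptic curve of a given curve is the locus of the intersection of tangents to the curve meeting at the constant angle $\alpha$. At the discrete parameter values where the derivative of the parametrization of the hypocycloid vanishes, the tangent direction is taken as the limit, so that it remains continuous. A hypocycloid is generated by a point on a circle rolling internally upon a fixed circle; here the fixed circle has radius $1$ and the rolling circle has radius $\frac1a=\frac pq$. A hypotrochoid is generated by a point rigidly attached to a circle rolling internally upon a fixed circle; in the parametrization above, $A$ and $B$ are the radii of the fixed and the rolling circle respectively, and $H$ is the distance of the tracing point from the center of the rolling circle. *)

theory Defs
  imports "HOL-Analysis.Analysis"
begin

definition hypocycloid :: "real \<Rightarrow> real \<Rightarrow> real \<times> real" where
  "hypocycloid a t =
     (((a - 1) * cos t + cos ((a - 1) * t)) / a,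
      ((a - 1) * sin t - sin ((a - 1) * t)) / a)"

definition hypotrochoid :: "real \<Rightarrow> real \<Rightarrow> real \<Rightarrow> real \<Rightarrow> real \<times> real" where
  "hypotrochoid A B H t =
     ((A - B) * cos t + H * cos ((A - B) / B * t),
      (A - B) * sin t - H * sin ((A - B) / B * t))"

text \<open>
  A continuous choice of the angle of the (unoriented) tangent direction along a curve.
  Where the derivative vanishes the second condition is void; if such parameters are
  isolated, the angle there is forced by continuity to be the limit.
  The velocity may reverse at a cusp, so the factor r can have either sign.
\<close>
definition tangent_angle :: "(real \<Rightarrow> real \<times> real) \<Rightarrow> (real \<Rightarrow> real) \<Rightarrow> bool" where
  "tangent_angle \<gamma> \<theta> \<longleftrightarrow>
     continuous_on UNIV \<theta> \<and>
     (\<forall>t v. (\<gamma> has_vector_derivative v) (at t) \<longrightarrow>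
        (\<exists>r. v = r *\<^sub>R (cos (\<theta> t), sin (\<theta> t))))"

definition tangent_line ::
    "(real \<Rightarrow> real \<times> real) \<Rightarrow> (real \<Rightarrow> real) \<Rightarrow> real \<Rightarrow> (real \<times> real) set" where
  "tangent_line \<gamma> \<theta> t = {\<gamma> t + r *\<^sub>R (cos (\<theta> t), sin (\<theta> t)) | r. True}"

text \<open>
  Two tangents meet at the angle \<open>\<alpha>\<close> if the continuous tangent direction turns by exactly
  \<open>\<alpha>\<close> between their points of contact. Reducing the angle modulo \<open>\<pi>\<close> or \<open>2\<pi>\<close> would
  give a different notion on curves whose tangent turns several times: the locus would then
  in general be a union of several curves.
  One point of contact ranges over the parameter set I of the curve, and the other is reached
  from it by following the curve in either direction, possibly beyond the ends of I. For a
  closed curve of which I covers a full period this is only a continuation of the angle,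
  because no new tangent lines occur outside I.
\<close>
definition isoptic ::
    "(real \<Rightarrow> real \<times> real) \<Rightarrow> real set \<Rightarrow> real \<Rightarrow> (real \<times> real) set" where
  "isoptic \<gamma> I \<alpha> =
     {P. \<exists>\<theta> s t. tangent_angle \<gamma> \<theta> \<and> s \<in> I \<and> \<bar>\<theta> t - \<theta> s\<bar> = \<alpha> \<and>
           P \<in> tangent_line \<gamma> \<theta> s \<inter> tangent_line \<gamma> \<theta> t}"

end

theory Submission
  imports Defs
begin

text \<open>
  The velocity at \<open>t\<close> is a multiple of \<open>(- cos (b * t), sin (b * t))\<close> with \<open>b = (a - 2) / 2\<close>,
  so every continuous tangent angle has the form \<open>k * pi - b * t\<close>, and the tangent at \<open>t\<close> is the
  line \<open>x * sin (b * t) + y * cos (b * t) = (a - 2) / a * sin (a / 2 * t)\<close>. Two tangents at angle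
  \<open>\<alpha>\<close> therefore touch at \<open>m - d\<close> and \<open>m + d\<close> with \<open>(a - 2) * d\<close> equal to \<open>\<alpha>\<close> or \<open>- \<alpha>\<close>, and
  their intersection is the point of the hypotrochoid with parameter \<open>m\<close> (for either sign). The
  shift from \<open>m - d\<close> to \<open>m\<close> is harmless because the hypotrochoid has period \<open>2 * p * pi\<close>, which is
  less than \<open>2 * q * pi\<close>.
\<close>

section \<open>Velocity and continuous tangent angles of the hypocycloid\<close>

text \<open>Sum-to-product formulas in the half angles \<open>u\<close> and \<open>v\<close> pull
  the same sine out of both coordinates. The remaining vector has length 1, so it still gives a
  direction at the cusps, where that sine vanishes.\<close>

lemma hypocycloid_has_vector_derivative:
  assumes "a \<noteq> 0"
  shows "(hypocycloid a has_vector_derivative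
           (2 * (a - 1) / a * sin (a * t / 2)) *\<^sub>R (- cos ((a - 2) / 2 * t), sin ((a - 2) / 2 * t))) (at t)"
proof -
  define u v where "u = a * t / 2" and "v = (a - 2) / 2 * t"
  have uv: "t = u - v" "(a - 1) * t = u + v"
    by (simp_all add: u_def v_def field_simps)
  have trig: "sin t + sin ((a - 1) * t) = 2 * sin u * cos v" "cos t - cos ((a - 1) * t) = 2 * sin u * sin v"
    unfolding uv(2) arg_cong[OF uv(1), of sin] arg_cong[OF uv(1), of cos]
    by (simp_all add: sin_add sin_diff cos_add cos_diff)
  have "((\<lambda>t. ((a - 1) * cos t + cos ((a - 1) * t)) / a) has_real_derivative
          - ((a - 1) / a * (sin t + sin ((a - 1) * t)))) (at t)"
    using assms by (auto intro!: derivative_eq_intros simp: field_simps)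
  moreover have "((\<lambda>t. ((a - 1) * sin t - sin ((a - 1) * t)) / a) has_real_derivative
          (a - 1) / a * (cos t - cos ((a - 1) * t))) (at t)"
    using assms by (auto intro!: derivative_eq_intros simp: field_simps)
  ultimately have "(hypocycloid a has_vector_derivative
      (- ((a - 1) / a * (2 * sin u * cos v)), (a - 1) / a * (2 * sin u * sin v))) (at t)"
    unfolding hypocycloid_def has_real_derivative_iff_has_vector_derivative trig
    by (rule has_vector_derivative_Pair)
  moreover have "(- ((a - 1) / a * (2 * sin u * cos v)), (a - 1) / a * (2 * sin u * sin v))
      = (2 * (a - 1) / a * sin u) *\<^sub>R (- cos v, sin v)"
    using assms by (simp add: scaleR_Pair field_simps)
  ultimately show ?thesis
    by (simp only: u_def v_def)
qed

text \<open>Zeros of a nonconstant sine are isolated, so the value of \<open>f\<close> at one of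
  them is a limit of zeros. This carries the direction condition across the cusps.\<close>

lemma isCont_zero_if_zero_off_sin_zeros:
  fixes f :: "real \<Rightarrow> real"
  assumes "isCont f t" and "c \<noteq> 0" and "\<And>x. sin (c * x) \<noteq> 0 \<Longrightarrow> f x = 0"
  shows "f t = 0"
proof (cases "sin (c * t) = 0")
  case True
  \<comment> \<open>Consecutive zeros of \<open>sin (c * x)\<close> are
    \<open>pi / \<bar>c\<bar>\<close> apart, so \<open>t\<close> is the only one in this
    neighbourhood.\<close>
  have "f x = 0" if "x \<noteq> t" "dist x t < pi / \<bar>c\<bar>" for x
  proof (rule assms(3))
    have "\<bar>c * (x - t)\<bar> < pi"
      using that assms(2) by (simp add: dist_real_def abs_mult pos_less_divide_eq mult.commute)
    then have "sin (c * (x - t)) \<noteq> 0"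
      using that assms(2) sin_eq_0_pi[of "c * (x - t)"] by (auto simp: abs_less_iff)
    moreover have "sin (c * x) = cos (c * t) * sin (c * (x - t))"
      using sin_add[of "c * t" "c * (x - t)"] True by (simp add: algebra_simps)
    moreover have "cos (c * t) \<noteq> 0"
      using True sin_cos_squared_add[of "c * t"] by auto
    ultimately show "sin (c * x) \<noteq> 0" by simp
  qed
  then have "eventually (\<lambda>x. f x = 0) (at t)"
    unfolding eventually_at using assms(2) by (intro exI[of _ "pi / \<bar>c\<bar>"]) auto
  then have "(f \<longlongrightarrow> 0) (at t)"
    by (rule tendsto_eventually)
  with assms(1) show ?thesis
    by (metis LIM_unique isCont_def)
qed (simp add: assms(3))

lemma continuous_Ints_valued_constant:
  fixes f :: "real \<Rightarrow> real"
  assumes "continuous_on UNIV f" and "\<And>x. f x \<in> \<int>"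
  obtains k :: int where "\<And>x. f x = of_int k"
proof -
  have "f constant_on UNIV"
  proof (rule continuous_discrete_range_constant[OF connected_UNIV assms(1)])
    fix x
    have "1 \<le> norm (f y - f x)" if "f y \<noteq> f x" for y
      using that assms(2)[of x] assms(2)[of y] by (auto elim!: Ints_cases simp flip: of_int_diff)
    then show "\<exists>e>0. \<forall>y. y \<in> UNIV \<and> f y \<noteq> f x \<longrightarrow> e \<le> norm (f y - f x)"
      by (intro exI[of _ 1]) auto
  qed
  then show ?thesis
    using assms(2)[of 0] that unfolding constant_on_def by (metis Ints_cases UNIV_I)
qed

text \<open>Off the cusps, being parallel to the velocity forces \<open>sin (f t) = 0\<close>;
  continuity extends this to all \<open>t\<close>. Then \<open>f t / pi\<close> is continuous and
  integer-valued, hence a constant \<open>k\<close>.\<close>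

lemma tangent_angle_hypocycloid_iff:
  assumes "a \<noteq> 0" "a \<noteq> 1"
  shows "tangent_angle (hypocycloid a) \<theta> \<longleftrightarrow>
           (\<exists>k::int. \<forall>t. \<theta> t = of_int k * pi - (a - 2) / 2 * t)"
proof
  assume \<theta>: "tangent_angle (hypocycloid a) \<theta>"
  define f where "f = (\<lambda>t. \<theta> t + (a - 2) / 2 * t)"
  have cont: "continuous_on UNIV f"
    using \<theta> unfolding f_def tangent_angle_def by (auto intro!: continuous_intros)
  have "sin (f t) = 0" if nz: "sin (a / 2 * t) \<noteq> 0" for t
  proof -
    define w where "w = 2 * (a - 1) / a * sin (a * t / 2)"
    have "w \<noteq> 0" using nz assms by (simp add: w_def)
    obtain r where "w *\<^sub>R (- cos ((a - 2) / 2 * t), sin ((a - 2) / 2 * t)) = r *\<^sub>R (cos (\<theta> t), sin (\<theta> t))"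
      using \<theta> hypocycloid_has_vector_derivative[OF assms(1), of t]
      unfolding tangent_angle_def w_def by blast
    then have "- (w * cos ((a - 2) / 2 * t)) = r * cos (\<theta> t)"
      "w * sin ((a - 2) / 2 * t) = r * sin (\<theta> t)"
      by (simp_all add: scaleR_Pair)
    \<comment> \<open>By the two equations the expansion becomes \<open>- r * cos (\<theta> t) * sin
      (\<theta> t) + r * sin (\<theta> t) * cos (\<theta> t)\<close>.\<close>
    then have "w * sin (f t) = 0"
      unfolding f_def sin_add by algebra
    with \<open>w \<noteq> 0\<close> show ?thesis by simp
  qed
  moreover have "isCont (\<lambda>t. sin (f t)) t" for t
    using cont by (simp add: continuous_on_eq_continuous_at isCont_sin)
  moreover have "a / 2 \<noteq> 0"
    using assms(1) by simp
  ultimately have "sin (f t) = 0" for t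
    using isCont_zero_if_zero_off_sin_zeros[of t "\<lambda>t. sin (f t)" "a / 2"] by blast
  then have "f t / pi \<in> \<int>" for t
    by (metis Ints_of_int nonzero_mult_div_cancel_right pi_neq_zero sin_zero_iff_int2)
  moreover have "continuous_on UNIV (\<lambda>t. f t / pi)"
    using cont by (intro continuous_on_divide) auto
  ultimately obtain k :: int where "\<And>t. f t / pi = of_int k"
    using continuous_Ints_valued_constant by metis
  then have "\<forall>t. \<theta> t = of_int k * pi - (a - 2) / 2 * t"
    by (simp add: f_def field_simps)
  then show "\<exists>k::int. \<forall>t. \<theta> t = of_int k * pi - (a - 2) / 2 * t" ..
next
  assume "\<exists>k::int. \<forall>t. \<theta> t = of_int k * pi - (a - 2) / 2 * t"
  then obtain k :: int where \<theta>: "\<And>t. \<theta> t = of_int k * pi - (a - 2) / 2 * t" by blast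
  show "tangent_angle (hypocycloid a) \<theta>"
    unfolding tangent_angle_def
  proof (intro conjI allI impI)
    show "continuous_on UNIV \<theta>"
      unfolding \<theta> by (auto intro!: continuous_intros)
    fix t v assume "(hypocycloid a has_vector_derivative v) (at t)"
    then have v: "v = (2 * (a - 1) / a * sin (a * t / 2)) *\<^sub>R (- cos ((a - 2) / 2 * t), sin ((a - 2) / 2 * t))"
      using hypocycloid_has_vector_derivative[OF assms(1)] vector_derivative_unique_at by blast
    \<comment> \<open>\<open>cos (of_int k * pi)\<close> is a sign, hence its own inverse; it serves
      as the orientation factor in the multiplier below.\<close>
    have "sin (of_int k * pi) = 0" and "cos (of_int k * pi) * cos (of_int k * pi) = 1"
      using sin_times_pi_eq_0[of "of_int k"] sin_cos_squared_add3[of "of_int k * pi"] by auto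
    then have "v = (- cos (of_int k * pi) * (2 * (a - 1) / a * sin (a * t / 2))) *\<^sub>R (cos (\<theta> t), sin (\<theta> t))"
      unfolding v \<theta> cos_diff sin_diff by (simp add: scaleR_Pair algebra_simps)
    then show "\<exists>r. v = r *\<^sub>R (cos (\<theta> t), sin (\<theta> t))" ..
  qed
qed

section \<open>Equations of the tangent lines\<close>

lemma mem_tangent_line_iff:
  "(x, y) \<in> tangent_line \<gamma> \<theta> t \<longleftrightarrow>
     (x - fst (\<gamma> t)) * sin (\<theta> t) = (y - snd (\<gamma> t)) * cos (\<theta> t)"
proof
  assume eq: "(x - fst (\<gamma> t)) * sin (\<theta> t) = (y - snd (\<gamma> t)) * cos (\<theta> t)"
  \<comment> \<open>The multiplier is the orthogonal projection onto the unit direction.\<close>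
  define r where "r = (x - fst (\<gamma> t)) * cos (\<theta> t) + (y - snd (\<gamma> t)) * sin (\<theta> t)"
  have "x - fst (\<gamma> t) = r * cos (\<theta> t)" "y - snd (\<gamma> t) = r * sin (\<theta> t)"
    using eq sin_cos_squared_add3[of "\<theta> t"] unfolding r_def by algebra+
  then have "(x, y) = \<gamma> t + r *\<^sub>R (cos (\<theta> t), sin (\<theta> t))"
    by (simp add: prod_eq_iff)
  then show "(x, y) \<in> tangent_line \<gamma> \<theta> t"
    unfolding tangent_line_def by blast
qed (auto simp: tangent_line_def prod_eq_iff)

text \<open>The integer \<open>k\<close> enters only through the nonzero common factor
  \<open>cos (of_int k * pi)\<close>, which cancels. The right side is the left side evaluated at
  the point of contact.\<close>

lemma mem_tangent_line_hypocycloid_iff: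
  fixes k :: int
  assumes "a \<noteq> 0" and "\<theta> t = of_int k * pi - (a - 2) / 2 * t"
  shows "(x, y) \<in> tangent_line (hypocycloid a) \<theta> t \<longleftrightarrow>
           x * sin ((a - 2) / 2 * t) + y * cos ((a - 2) / 2 * t) = (a - 2) / a * sin (a / 2 * t)"
proof -
  define u v where "u = a / 2 * t" and "v = (a - 2) / 2 * t"
  have uv: "t = u - v" "(a - 1) * t = u + v"
    by (simp_all add: u_def v_def field_simps)
  have "sin (of_int k * pi) = 0" and "cos (of_int k * pi) \<noteq> 0"
    using sin_times_pi_eq_0[of "of_int k"] sin_cos_squared_add3[of "of_int k * pi"] by auto
  then have "(x, y) \<in> tangent_line (hypocycloid a) \<theta> t \<longleftrightarrow>
      (x - fst (hypocycloid a t)) * sin v + (y - snd (hypocycloid a t)) * cos v = 0"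
    unfolding mem_tangent_line_iff assms(2) v_def[symmetric] cos_diff sin_diff
    by (auto simp: algebra_simps)
  moreover have "fst (hypocycloid a t) * sin v + snd (hypocycloid a t) * cos v = (a - 2) / a * sin u"
  proof -
    have "a * fst (hypocycloid a t) = (a - 1) * cos t + cos ((a - 1) * t)"
      "a * snd (hypocycloid a t) = (a - 1) * sin t - sin ((a - 1) * t)"
      using assms(1) by (simp_all add: hypocycloid_def)
    then have "a * (fst (hypocycloid a t) * sin v + snd (hypocycloid a t) * cos v)
        = (a - 1) * sin (t + v) - sin ((a - 1) * t - v)"
      unfolding sin_add sin_diff by algebra
    \<comment> \<open>Both arguments \<open>t + v\<close> and \<open>(a - 1) * t - v\<close> equal
      \<open>u\<close>.\<close>
    also have "\<dots> = (a - 2) * sin u"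
      by (simp add: uv(2)) (simp add: uv(1) algebra_simps)
    finally show ?thesis
      using assms(1) by (simp add: field_simps)
  qed
  ultimately show ?thesis
    by (simp add: u_def v_def algebra_simps)
qed

section \<open>Intersection of two tangents\<close>

text \<open>The frequency \<open>n\<close> is a parameter of its own, so that the curve also makes
  sense where the quotient \<open>(A - B) / B\<close> of \<open>hypotrochoid\<close>
  degenerates.\<close>

definition trochoid :: "real \<Rightarrow> real \<Rightarrow> real \<Rightarrow> real \<Rightarrow> real \<times> real" where
  "trochoid n C H m = (C * cos m + H * cos (n * m), C * sin m - H * sin (n * m))"

text \<open>
  The sum and the difference of the two line equations are linear equations for the coordinates
  of the intersection point in the frame rotated by \<open>(a - 2) / 2 * m\<close>.
\<close>
lemma hypocycloid_tangents_intersection: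
  fixes a m d x y :: real
  defines "e \<equiv> (a - 2) * d" and "b \<equiv> (a - 2) / 2"
  assumes "a \<noteq> 0" and "sin e \<noteq> 0"
  shows "x * sin (b * (m - d)) + y * cos (b * (m - d)) = (a - 2) / a * sin (a / 2 * (m - d)) \<and>
         x * sin (b * (m + d)) + y * cos (b * (m + d)) = (a - 2) / a * sin (a / 2 * (m + d)) \<longleftrightarrow>
         (x, y) = trochoid (a - 1) ((a - 2) * sin ((a - 1) * d) / (a * sin e))
                    ((a - 2) * sin d / (a * sin e)) m"
proof -
  define u v w f where "u = a / 2 * m" and "v = b * m" and "w = a / 2 * d" and "f = b * d"
  define c where "c = (a - 2) / a"
  define S D where "S = x * sin v + y * cos v" and "D = x * cos v - y * sin v"
  have args: "b * (m - d) = v - f" "b * (m + d) = v + f" "a / 2 * (m - d) = u - w"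
    "a / 2 * (m + d) = u + w" "m = u - v" "(a - 1) * m = u + v" "(a - 1) * d = w + f" "d = w - f"
    "e = 2 * f"
    by (simp_all add: u_def v_def w_def f_def b_def e_def field_simps)
  have nz: "sin f \<noteq> 0" "cos f \<noteq> 0"
    using assms(4) unfolding args(9) sin_double by auto
  have e: "sin e = 2 * sin f * cos f"
    by (simp add: args(9) sin_double)
  have v1: "sin v * sin v + cos v * cos v = 1"
    using sin_cos_squared_add3[of v] by (simp add: add.commute)
  have "x * sin (b * (m - d)) + y * cos (b * (m - d)) = c * sin (a / 2 * (m - d)) \<and>
        x * sin (b * (m + d)) + y * cos (b * (m + d)) = c * sin (a / 2 * (m + d)) \<longleftrightarrow>
        S * cos f = c * sin u * cos w \<and> D * sin f = c * cos u * sin w"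
    unfolding args(1-4) sin_add sin_diff cos_add cos_diff S_def D_def
    by (auto simp: algebra_simps)
  \<comment> \<open>Multiplying by the nonzero factors \<open>2 * sin f\<close> and
    \<open>2 * cos f\<close> gives both equations the common coefficient
    \<open>sin e\<close>.\<close>
  also have "\<dots> \<longleftrightarrow> S * sin e = 2 * c * sin u * cos w * sin f \<and> D * sin e = 2 * c * cos u * sin w * cos f"
    using nz unfolding e by auto
  \<comment> \<open>Rotating back by \<open>v\<close> recovers \<open>x\<close> and \<open>y\<close>
    from \<open>S\<close> and \<open>D\<close>.\<close>
  also have "\<dots> \<longleftrightarrow> x * sin e = c * (sin (w + f) * cos (u - v) + sin (w - f) * cos (u + v)) \<and>
      y * sin e = c * (sin (w + f) * sin (u - v) - sin (w - f) * sin (u + v))"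
    (is "_ \<longleftrightarrow> ?X \<and> ?Y")
  proof
    assume "S * sin e = 2 * c * sin u * cos w * sin f \<and> D * sin e = 2 * c * cos u * sin w * cos f"
    then show "?X \<and> ?Y"
      using v1 unfolding S_def D_def sin_add sin_diff cos_add cos_diff by algebra
  next
    assume "?X \<and> ?Y"
    then show "S * sin e = 2 * c * sin u * cos w * sin f \<and> D * sin e = 2 * c * cos u * sin w * cos f"
      using v1 unfolding S_def D_def sin_add sin_diff cos_add cos_diff by algebra
  qed
  also have "\<dots> \<longleftrightarrow> (x, y) = trochoid (a - 1) ((a - 2) * sin (w + f) / (a * sin e))
                    ((a - 2) * sin (w - f) / (a * sin e)) m"
  proof -
    have scale: "z * sin e = c * (g * h + g' * h') \<longleftrightarrow>
        z = (a - 2) * g / (a * sin e) * h + (a - 2) * g' / (a * sin e) * h'" for z g h g' h'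
      using assms(3,4) by (simp add: c_def nonzero_eq_divide_eq add_divide_distrib[symmetric])
         (simp add: algebra_simps)
    show ?thesis
      unfolding trochoid_def args(6)
      using scale[of x] scale[of y _ _ "sin (w - f)" "- sin (u + v)"] by (simp add: args(5))
  qed
  finally show ?thesis
    unfolding c_def args(7) by (simp flip: args(8))
qed

lemma mem_hypocycloid_tangents_iff:
  fixes a m d :: real and k :: int
  assumes "a \<noteq> 0" and "sin ((a - 2) * d) \<noteq> 0"
    and "\<And>t. \<theta> t = of_int k * pi - (a - 2) / 2 * t"
  shows "P \<in> tangent_line (hypocycloid a) \<theta> (m - d) \<inter> tangent_line (hypocycloid a) \<theta> (m + d) \<longleftrightarrow>
         P = trochoid (a - 1) ((a - 2) * sin ((a - 1) * d) / (a * sin ((a - 2) * d)))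
               ((a - 2) * sin d / (a * sin ((a - 2) * d))) m"
proof (cases P)
  case (Pair x y)
  show ?thesis
    unfolding Pair Int_iff mem_tangent_line_hypocycloid_iff[of a \<theta>, OF assms(1,3)]
    by (rule hypocycloid_tangents_intersection[OF assms(1,2)])
qed

section \<open>The isoptic as a trochoid\<close>

lemma isoptic_hypocycloid:
  fixes a \<alpha> L T :: real
  defines "C \<equiv> (a - 2) * sin ((a - 1) * \<alpha> / (a - 2)) / (a * sin \<alpha>)"
    and "H \<equiv> (a - 2) * sin (\<alpha> / (a - 2)) / (a * sin \<alpha>)"
  assumes a: "a \<noteq> 0" "a \<noteq> 1" "a \<noteq> 2" and \<alpha>: "0 < \<alpha>" "\<alpha> < pi"
    and T: "0 < T" "T \<le> L" "\<And>m. trochoid (a - 1) C H (m + T) = trochoid (a - 1) C H m"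
  shows "isoptic (hypocycloid a) {0..L} \<alpha> = trochoid (a - 1) C H ` {0..L}"
proof -
  let ?f = "trochoid (a - 1) C H"
  interpret periodic_fun_simple ?f T
    by unfold_locales (rule T(3))
  \<comment> \<open>Every window of length \<open>T\<close> contains a parameter for each point of
    the trochoid.\<close>
  have shift: "\<exists>m'\<in>{x..x + T}. ?f m' = ?f m" for x m
  proof
    let ?k = "\<lfloor>(m - x) / T\<rfloor>"
    show "?f (m - of_int ?k * T) = ?f m" by (rule minus_of_int)
    show "m - of_int ?k * T \<in> {x..x + T}"
      using floor_divide_lower[OF T(1), of "m - x"] floor_divide_upper[OF T(1), of "m - x"]
      by (simp add: algebra_simps)
  qed
  have sin\<alpha>: "sin \<alpha> \<noteq> 0"
    using \<alpha> sin_gt_zero by force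
  show ?thesis
  proof (intro set_eqI iffI)
    fix P assume "P \<in> isoptic (hypocycloid a) {0..L} \<alpha>"
    then obtain \<theta> s t where \<theta>: "tangent_angle (hypocycloid a) \<theta>" and ang: "\<bar>\<theta> t - \<theta> s\<bar> = \<alpha>"
      and P: "P \<in> tangent_line (hypocycloid a) \<theta> s" "P \<in> tangent_line (hypocycloid a) \<theta> t"
      unfolding isoptic_def by blast
    obtain k :: int where k: "\<And>t. \<theta> t = of_int k * pi - (a - 2) / 2 * t"
      using \<theta> tangent_angle_hypocycloid_iff[OF a(1,2)] by blast
    define m d where "m = (s + t) / 2" and "d = (t - s) / 2"
    have st: "s = m - d" "t = m + d"
      by (simp_all add: m_def d_def field_simps)
    have "\<bar>(a - 2) * d\<bar> = \<alpha>"
      using ang by (simp add: k d_def algebra_simps abs_minus_commute diff_divide_distrib)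
    then have e: "(a - 2) * d = \<alpha> \<or> (a - 2) * d = - \<alpha>" by linarith
    then have nz: "sin ((a - 2) * d) \<noteq> 0" using sin\<alpha> by auto
    have "P = trochoid (a - 1) ((a - 2) * sin ((a - 1) * d) / (a * sin ((a - 2) * d)))
                     ((a - 2) * sin d / (a * sin ((a - 2) * d))) m"
      using P[unfolded st] mem_hypocycloid_tangents_iff[of a d \<theta>, OF a(1) nz k] by blast
    moreover have "d = \<alpha> / (a - 2) \<or> d = - (\<alpha> / (a - 2))"
      using e a(3) by (auto simp: field_simps)
    \<comment> \<open>Replacing \<open>d\<close> by \<open>- d\<close> flips numerator and
      denominator in both coefficients, so the two signs give the same curve.\<close>
    ultimately have "P = ?f m"
      using a(3) by (elim disjE) (simp_all add: C_def H_def)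
    moreover obtain m' where "m' \<in> {0..0 + T}" "?f m' = ?f m"
      using shift by blast
    ultimately show "P \<in> ?f ` {0..L}"
      using T(2) by (intro image_eqI[of _ _ m']) auto
  next
    fix P assume "P \<in> ?f ` {0..L}"
    define d where "d = \<alpha> / (a - 2)"
    have e: "(a - 2) * d = \<alpha>" using a(3) by (simp add: d_def)
    \<comment> \<open>The window starts at \<open>d\<close>, so that the contact parameter
      \<open>m - d\<close> lands in \<open>{0..T}\<close>.\<close>
    obtain m where m: "m \<in> {d..d + T}" and "P = ?f m"
      using \<open>P \<in> ?f ` {0..L}\<close> shift[of d] by (metis imageE)
    then have P: "P = trochoid (a - 1) ((a - 2) * sin ((a - 1) * d) / (a * sin ((a - 2) * d)))
                     ((a - 2) * sin d / (a * sin ((a - 2) * d))) m"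
      unfolding e by (simp add: C_def H_def d_def)
    have nz: "sin ((a - 2) * d) \<noteq> 0" using e sin\<alpha> by simp
    define \<theta> where "\<theta> = (\<lambda>t. of_int 0 * pi - (a - 2) / 2 * t)"
    have \<theta>: "\<theta> t = of_int 0 * pi - (a - 2) / 2 * t" for t
      by (simp only: \<theta>_def)
    have "tangent_angle (hypocycloid a) \<theta>"
      unfolding tangent_angle_hypocycloid_iff[OF a(1,2)] using \<theta> by blast
    moreover have "m - d \<in> {0..L}" using m T(2) by auto
    moreover have "\<theta> (m + d) - \<theta> (m - d) = - ((a - 2) * d)"
      by (simp add: \<theta>_def field_simps)
    then have "\<bar>\<theta> (m + d) - \<theta> (m - d)\<bar> = \<alpha>"
      using e \<alpha>(1) by simp
    moreover have "P \<in> tangent_line (hypocycloid a) \<theta> (m - d) \<inter> tangent_line (hypocycloid a) \<theta> (m + d)"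
      using P mem_hypocycloid_tangents_iff[of a d \<theta>, OF a(1) nz \<theta>] by blast
    ultimately show "P \<in> isoptic (hypocycloid a) {0..L} \<alpha>"
      unfolding isoptic_def by blast
  qed
qed

text \<open>The ratio \<open>(A - B) / B\<close> equals \<open>a - 1\<close> whenever
  \<open>B\<close> is nonzero. For \<open>B = 0\<close> also \<open>A = 0\<close>, the ratio has no
  meaning, and the frequency \<open>a - 1\<close> is written out.\<close>

theorem theorem3p3:
  fixes p q :: nat and a \<alpha> A B H :: real
  assumes "0 < p" and "p < q" and "2 * p \<noteq> q"
    and "a = real q / real p"
    and "0 < \<alpha>" and "\<alpha> < pi"
    and "A = (a - 2) * sin ((a - 1) * \<alpha> / (a - 2)) / ((a - 1) * sin \<alpha>)"
    and "B = (a - 2) * sin ((a - 1) * \<alpha> / (a - 2)) / (a * (a - 1) * sin \<alpha>)"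
    and "H = (a - 2) * sin (\<alpha> / (a - 2)) / (a * sin \<alpha>)"
  shows "(B \<noteq> 0 \<longrightarrow>
           isoptic (hypocycloid a) {0..2 * real q * pi} \<alpha>
             = hypotrochoid A B H ` {0..2 * real q * pi}) \<and>
         (B = 0 \<longrightarrow>
           isoptic (hypocycloid a) {0..2 * real q * pi} \<alpha>
             = (\<lambda>t. ((A - B) * cos t + H * cos ((a - 1) * t),
                     (A - B) * sin t - H * sin ((a - 1) * t))) ` {0..2 * real q * pi})"
proof -
  have a: "a \<noteq> 0" "a \<noteq> 1" "a \<noteq> 2"
    using assms(1-4) by (auto simp: field_simps)
  define C where "C = (a - 2) * sin ((a - 1) * \<alpha> / (a - 2)) / (a * sin \<alpha>)"
  have "sin \<alpha> \<noteq> 0"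
    using assms(5,6) sin_gt_zero by force
  have AB: "A = a * B"
    using assms(7,8) a by simp
  have C: "A - B = C"
  proof -
    have "A - B = (a - 1) * B"
      by (simp add: AB algebra_simps)
    then show ?thesis
      using a by (simp add: assms(8) C_def)
  qed
  have "trochoid (a - 1) C H (m + 2 * real p * pi) = trochoid (a - 1) C H m" for m
  proof -
    \<comment> \<open>Over \<open>2 * real p * pi\<close> the two terms make \<open>p\<close> and
      \<open>q - p\<close> full turns, since \<open>(a - 1) * p = q - p\<close>.\<close>
    have "(a - 1) * (m + 2 * real p * pi) = (a - 1) * m + of_nat (q - p) * (2 * pi)"
      "m + 2 * real p * pi = m + of_nat p * (2 * pi)"
      using assms(1,2) by (simp_all add: assms(4) of_nat_diff field_simps)
    moreover have "sin (x + of_nat n * (2 * pi)) = sin x" "cos (x + of_nat n * (2 * pi)) = cos x" for x n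
      using sin.plus_of_nat[of x n] cos.plus_of_nat[of x n] by simp_all
    ultimately show ?thesis
      unfolding trochoid_def by (simp only:)
  qed
  then have *: "isoptic (hypocycloid a) {0..2 * real q * pi} \<alpha>
      = trochoid (a - 1) C H ` {0..2 * real q * pi}"
    unfolding C_def assms(9) using a assms(1,2,5,6)
    by (intro isoptic_hypocycloid[where T = "2 * real p * pi"]) auto
  show ?thesis
  proof (intro conjI impI)
    assume "B \<noteq> 0"
    then have "(A - B) / B = a - 1"
      by (simp add: AB field_simps)
    then show "isoptic (hypocycloid a) {0..2 * real q * pi} \<alpha>
        = hypotrochoid A B H ` {0..2 * real q * pi}"
      unfolding * by (simp add: trochoid_def hypotrochoid_def C)
  qed (simp add: * trochoid_def flip: C)
qed

end
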